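(* Let $G$ be an Eulerian graph. Then $p_{2,\mathrm{iso}}(G) = \mathrm{la}(G)$. Moreover, if $\mathrm{la}(G) \leq 2$, then $p_2(G) = \mathrm{la}(G)$.
   Context: All graphs are finite and simple. A graph is Eulerian if every vertex has even degree (it need not be connected). A path odd-cover of a graph $G=(V,E)$ is a collection of paths in the complete graph on $V$ whose edge sets have symmetric difference equal to $E$; $p_2(G)$ is the minimum cardinality of a path odd-cover of $G$. $p_{2,\mathrm{iso}}(G)$ is the minimum of $p_2(H)$ over all graphs $H$ obtained from $G$ by adding (any number, possibly zero, of) isolated vertices. A linear forest is a graph each of whose components is a path; the linear arboricity $\mathrm{la}(G)$ is the minimum number of edge-disjoint linear forests whose union is $E(G)$. *)

theory Defs
  imports Main
begin

text \<open>A graph is a pair of a vertex set and a set of edges, an edge being a set of two vertices.\<close>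

type_synonym 'a graph = "'a set \<times> 'a set set"

abbreviation verts :: "'a graph \<Rightarrow> 'a set" where
  "verts G \<equiv> fst G"

abbreviation edges :: "'a graph \<Rightarrow> 'a set set" where
  "edges G \<equiv> snd G"

definition finite_simple_graph :: "'a graph \<Rightarrow> bool" where
  "finite_simple_graph G \<longleftrightarrow>
     finite (verts G) \<and> (\<forall>e\<in>edges G. e \<subseteq> verts G \<and> card e = 2)"

definition subgraph :: "'a graph \<Rightarrow> 'a graph \<Rightarrow> bool" where
  "subgraph H G \<longleftrightarrow> verts H \<subseteq> verts G \<and> edges H \<subseteq> edges G"

definition complete_graph :: "'a set \<Rightarrow> 'a graph" where
  "complete_graph V = (V, {e. e \<subseteq> V \<and> card e = 2})"

definition degree :: "'a graph \<Rightarrow> 'a \<Rightarrow> nat" where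
  "degree G v = card {e \<in> edges G. v \<in> e}"

definition eulerian :: "'a graph \<Rightarrow> bool" where
  "eulerian G \<longleftrightarrow> (\<forall>v\<in>verts G. even (degree G v))"

text \<open>Paths are graphs, not vertex sequences, so a path and its reversal are the same object.
  A single vertex is a path without edges.\<close>

definition path_graph :: "'a graph \<Rightarrow> bool" where
  "path_graph P \<longleftrightarrow>
     (\<exists>vs. vs \<noteq> [] \<and> distinct vs \<and>
           P = (set vs, {{vs ! i, vs ! Suc i} | i. Suc i < length vs}))"

text \<open>The symmetric difference of finitely many sets consists of the elements lying in an odd
  number of them. Two equal members of a collection would cancel, so taking collections
  without repetition does not affect the minimum cardinality.\<close>

definition path_odd_cover :: "'a graph \<Rightarrow> 'a graph set \<Rightarrow> bool" where
  "path_odd_cover G C \<longleftrightarrow>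
     finite C \<and>
     (\<forall>P\<in>C. path_graph P \<and> subgraph P (complete_graph (verts G))) \<and>
     {e. odd (card {P \<in> C. e \<in> edges P})} = edges G"

text \<open>For a finite simple graph the minimum exists: its single edges, viewed as paths, form
  a path odd-cover.\<close>

definition p2 :: "'a graph \<Rightarrow> nat" where
  "p2 G = (LEAST n. \<exists>C. path_odd_cover G C \<and> card C = n)"

text \<open>Since a vertex type may be finite, the \<open>k\<close> new isolated vertices live in a second
  summand; the vertices of \<open>G\<close> are tagged with \<^const>\<open>Inl\<close>.\<close>

definition add_isolated :: "nat \<Rightarrow> 'a graph \<Rightarrow> ('a + nat) graph" where
  "add_isolated k G = (Inl ` verts G \<union> Inr ` {..<k}, (\<lambda>e. Inl ` e) ` edges G)"

definition p2_iso :: "'a graph \<Rightarrow> nat" where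
  "p2_iso G = (LEAST n. \<exists>k. p2 (add_isolated k G) = n)"

definition component_of :: "'a graph \<Rightarrow> 'a \<Rightarrow> 'a graph" where
  "component_of G v =
     (let W = {w \<in> verts G. (v, w) \<in> {(x, y). {x, y} \<in> edges G}\<^sup>*}
      in (W, {e \<in> edges G. e \<subseteq> W}))"

definition linear_forest :: "'a graph \<Rightarrow> bool" where
  "linear_forest F \<longleftrightarrow>
     finite_simple_graph F \<and> (\<forall>v\<in>verts F. path_graph (component_of F v))"

definition linear_forest_decomposition :: "'a graph \<Rightarrow> 'a graph set \<Rightarrow> bool" where
  "linear_forest_decomposition G D \<longleftrightarrow>
     finite D \<and>
     (\<forall>F\<in>D. linear_forest F \<and> subgraph F G) \<and>
     pairwise (\<lambda>F F'. edges F \<inter> edges F' = {}) D \<and>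
     (\<Union>F\<in>D. edges F) = edges G"

text \<open>Again the minimum exists: the single edges form a decomposition.\<close>

definition linear_arboricity :: "'a graph \<Rightarrow> nat" where
  "linear_arboricity G = (LEAST n. \<exists>D. linear_forest_decomposition G D \<and> card D = n)"

end

(* Lower bound: assign every edge of G to one path of the odd cover containing it; a subset of
   the edges of a path is a linear forest. Upper bound: in an Eulerian graph every vertex is an
   end of an even number of the linear forests. Hence paths of the same forest can be joined
   repeatedly, adding every new edge to exactly two forests, until each forest is a single
   path. Fresh vertices are only needed when three forests are involved in a joining step. *)

theory Submission
  imports Defs
begin

section \<open>Paths as vertex lists\<close>

text \<open>A vertex has odd degree in a linear forest exactly if it is an end of a path with at
  least one edge, and degree parities add up over symmetric differences. This is where evenness
  enters: an end in one forest recurs as an end in another. A joining step puts each new edge into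
  two forests that lacked it, so the edge set covered modulo 2 stays the same and the argument can
  be repeated until the paths run out. The obstacle is cycles: an edge added to one forest must be
  compensated in another, where it must again link ends of two different paths. A path has only two
  ends, which leaves just enough freedom in choosing the second end of the new edge.\<close>

fun path_edges :: "'a list \<Rightarrow> 'a set set" where
  "path_edges (x # y # zs) = insert {x, y} (path_edges (y # zs))"
| "path_edges _ = {}"

text \<open>Links the recursive edge set, on which the inductions run, to the indexed one in the
  definition of a path.\<close>

lemma path_edges_nth: "path_edges vs = {{vs ! i, vs ! Suc i} | i. Suc i < length vs}"
proof (induction vs rule: path_edges.induct)
  case (1 x y zs)
  have "{{(x # y # zs) ! i, (x # y # zs) ! Suc i} | i. Suc i < length (x # y # zs)} =
        insert {x, y} {{(y # zs) ! i, (y # zs) ! Suc i} | i. Suc i < length (y # zs)}"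
    (is "?L = ?R")
  proof
    show "?L \<subseteq> ?R"
    proof
      fix e assume "e \<in> ?L"
      then obtain i where i: "e = {(x # y # zs) ! i, (x # y # zs) ! Suc i}"
        "Suc i < length (x # y # zs)" by blast
      show "e \<in> ?R"
      proof (cases i)
        case 0
        then show ?thesis using i by simp
      next
        case (Suc k)
        then have "e = {(y # zs) ! k, (y # zs) ! Suc k}" "Suc k < length (y # zs)"
          using i by simp_all
        then show ?thesis by blast
      qed
    qed
    show "?R \<subseteq> ?L"
    proof
      fix e assume "e \<in> ?R"
      then consider "e = {x, y}"
        | i where "e = {(y # zs) ! i, (y # zs) ! Suc i}" "Suc i < length (y # zs)" by blast
      then show "e \<in> ?L"
      proof cases
        case 1
        then have "e = {(x # y # zs) ! 0, (x # y # zs) ! Suc 0}" by simp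
        then show ?thesis by fastforce
      next
        case 2
        then have "e = {(x # y # zs) ! Suc i, (x # y # zs) ! Suc (Suc i)}"
          "Suc (Suc i) < length (x # y # zs)" by simp_all
        then show ?thesis by blast
      qed
    qed
  qed
  then show ?case using 1 by simp
qed auto

lemma path_graph_iff:
  "path_graph P \<longleftrightarrow> (\<exists>vs. vs \<noteq> [] \<and> distinct vs \<and> P = (set vs, path_edges vs))"
  unfolding path_graph_def path_edges_nth ..

lemma path_edges_subset: "e \<in> path_edges vs \<Longrightarrow> e \<subseteq> set vs"
  by (induction vs rule: path_edges.induct) auto

lemma path_edges_card: "distinct vs \<Longrightarrow> e \<in> path_edges vs \<Longrightarrow> card e = 2"
  by (induction vs rule: path_edges.induct) auto

lemma finite_path_edges [simp]: "finite (path_edges vs)"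
  by (induction vs rule: path_edges.induct) auto

lemma path_edges_append:
  "xs \<noteq> [] \<Longrightarrow> ys \<noteq> [] \<Longrightarrow>
   path_edges (xs @ ys) = insert {last xs, hd ys} (path_edges xs \<union> path_edges ys)"
proof (induction xs rule: path_edges.induct)
  case ("2_2" v)
  then show ?case by (cases ys) auto
qed auto

lemma path_edges_rev: "path_edges (rev vs) = path_edges vs"
proof (induction vs rule: path_edges.induct)
  case (1 x y zs)
  have "path_edges (rev (x # y # zs)) = path_edges (rev (y # zs) @ [x])" by simp
  also have "\<dots> = insert {last (rev (y # zs)), x} (path_edges (rev (y # zs)))"
    by (subst path_edges_append) auto
  finally show ?case using 1 by (simp add: insert_commute last_rev)
qed auto

lemma path_edges_map: "path_edges (map f vs) = (`) f ` path_edges vs"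
  by (induction vs rule: path_edges.induct) auto

text \<open>Prepending \<open>x\<close> to a list starting with \<open>y\<close> flips the parity at
  \<open>x\<close> and at \<open>y\<close> only. The exclusive or also covers a one-vertex list,
  whose vertex has degree 0.\<close>

lemma odd_degree_path_edges:
  "distinct vs \<Longrightarrow> vs \<noteq> [] \<Longrightarrow>
   odd (card {e \<in> path_edges vs. v \<in> e}) \<longleftrightarrow> (v = hd vs) \<noteq> (v = last vs)"
proof (induction vs rule: path_edges.induct)
  case (1 x y zs)
  let ?X = "{e \<in> path_edges (y # zs). v \<in> e}"
  have new: "{x, y} \<notin> path_edges (y # zs)"
    using path_edges_subset[of "{x, y}" "y # zs"] 1(2) by auto
  have "{e \<in> path_edges (x # y # zs). v \<in> e} = (if v \<in> {x, y} then insert {x, y} ?X else ?X)"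
    by auto
  moreover have "finite ?X" by simp
  ultimately have "odd (card {e \<in> path_edges (x # y # zs). v \<in> e}) \<longleftrightarrow>
      (odd (card ?X) \<noteq> (v \<in> {x, y}))"
    using new by auto
  moreover have "odd (card ?X) \<longleftrightarrow> (v = y) \<noteq> (v = last (y # zs))"
    using 1 by simp
  moreover have "x \<noteq> y" "x \<noteq> last (y # zs)"
    using 1(2) by (auto split: if_splits)
  ultimately show ?case by auto
qed auto

lemma path_reoriented:
  assumes "a \<in> {hd p, last p}" "p \<noteq> []"
  obtains q where "last q = a" "set q = set p" "distinct q = distinct p"
    "length q = length p" "path_edges q = path_edges p"
proof (cases "a = last p")
  case False
  then have "last (rev p) = a" using assms by (simp add: last_rev)
  then show ?thesis using that[of "rev p"] by (simp add: path_edges_rev)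
qed (use that in blast)

section \<open>Systems of vertex-disjoint paths\<close>

text \<open>A linear forest without its isolated vertices. Length at least 2 makes the two ends
  distinct, hence of odd degree, and disjointness excludes listing a path in both orientations, so
  \<open>card S\<close> is the number of paths.\<close>

definition path_system :: "'a list set \<Rightarrow> bool" where
  "path_system S \<longleftrightarrow> finite S \<and> (\<forall>p\<in>S. 2 \<le> length p \<and> distinct p) \<and>
     (\<forall>p\<in>S. \<forall>q\<in>S. p \<noteq> q \<longrightarrow> set p \<inter> set q = {})"

definition system_verts :: "'a list set \<Rightarrow> 'a set" where
  "system_verts S = (\<Union>p\<in>S. set p)"

definition system_edges :: "'a list set \<Rightarrow> 'a set set" where
  "system_edges S = (\<Union>p\<in>S. path_edges p)"

definition system_ends :: "'a list set \<Rightarrow> 'a set" where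
  "system_ends S = (\<Union>p\<in>S. {hd p, last p})"

lemma path_systemD:
  assumes "path_system S"
  shows "finite S" "p \<in> S \<Longrightarrow> 2 \<le> length p" "p \<in> S \<Longrightarrow> distinct p" "p \<in> S \<Longrightarrow> p \<noteq> []"
    "p \<in> S \<Longrightarrow> q \<in> S \<Longrightarrow> v \<in> set p \<Longrightarrow> v \<in> set q \<Longrightarrow> p = q"
  using assms unfolding path_system_def by fastforce+

lemma hd_neq_last: "2 \<le> length p \<Longrightarrow> distinct p \<Longrightarrow> hd p \<noteq> last p"
  by (cases p) auto

lemma system_edges_subset: "e \<in> system_edges S \<Longrightarrow> e \<subseteq> system_verts S"
  unfolding system_edges_def system_verts_def using path_edges_subset by fast

text \<open>Used contrapositively: a pair taken from two different paths is not yet an edge, so an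
  edge joining them is new.\<close>

lemma system_edges_same_path:
  assumes S: "path_system S" and p: "p \<in> S" "u \<in> set p" and q: "q \<in> S" "w \<in> set q"
    and e: "{u, w} \<in> system_edges S"
  shows "p = q"
proof -
  obtain r where r: "r \<in> S" "{u, w} \<in> path_edges r" using e unfolding system_edges_def by blast
  then have "u \<in> set r" "w \<in> set r" using path_edges_subset[OF r(2)] by auto
  then have "p = r" "q = r"
    using path_systemD(5)[OF S p(1) r(1) p(2)] path_systemD(5)[OF S q(1) r(1) q(2)] by auto
  then show ?thesis by simp
qed

lemma system_edges_card: "path_system S \<Longrightarrow> e \<in> system_edges S \<Longrightarrow> card e = 2"
  unfolding system_edges_def using path_edges_card path_systemD(3) by blast

lemma finite_system_edges: "path_system S \<Longrightarrow> finite (system_edges S)"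
  unfolding system_edges_def by (simp add: path_systemD(1))

text \<open>At most one path passes through \<open>v\<close>, so the degree of \<open>v\<close> in
  the system is its degree in that path. This turns parity of degrees into availability of path
  ends.\<close>

lemma odd_degree_system_edges:
  assumes S: "path_system S"
  shows "odd (card {e \<in> system_edges S. v \<in> e}) \<longleftrightarrow> v \<in> system_ends S"
proof (cases "v \<in> system_verts S")
  case True
  then obtain p where p: "p \<in> S" "v \<in> set p" unfolding system_verts_def by blast
  note pS = path_systemD[OF S]
  have uniq: "q = p" if "q \<in> S" "v \<in> set q" for q
    using pS(5)[OF that(1) p(1) that(2) p(2)] .
  have through: "e \<in> path_edges p" if "q \<in> S" "e \<in> path_edges q" "v \<in> e" for e q
    using uniq[OF that(1)] path_edges_subset[OF that(2)] that by blast
  have "{e \<in> system_edges S. v \<in> e} = {e \<in> path_edges p. v \<in> e}"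
    unfolding system_edges_def using p(1) through by blast
  moreover have "odd (card {e \<in> path_edges p. v \<in> e}) \<longleftrightarrow> v \<in> {hd p, last p}"
    using odd_degree_path_edges[of p v] pS(2-4)[OF p(1)] hd_neq_last[of p] by auto
  moreover have "v \<in> system_ends S \<longleftrightarrow> v \<in> {hd p, last p}"
  proof
    assume "v \<in> system_ends S"
    then obtain q where q: "q \<in> S" "v \<in> {hd q, last q}" unfolding system_ends_def by blast
    then have "v \<in> set q" using pS(4)[OF q(1)] by auto
    then show "v \<in> {hd p, last p}" using q uniq by blast
  qed (use p in \<open>auto simp: system_ends_def\<close>)
  ultimately show ?thesis by simp
next
  case False
  then have empty: "{e \<in> system_edges S. v \<in> e} = {}" using system_edges_subset by blast
  have "v \<notin> system_ends S"
    using False path_systemD(4)[OF S] unfolding system_ends_def system_verts_def by fastforce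
  then show ?thesis unfolding empty by simp
qed

lemma path_system_replace:
  assumes S: "path_system S" and r: "2 \<le> length r" "distinct r"
    and disj: "set r \<inter> system_verts (S - P) = {}"
  shows "path_system (insert r (S - P))" "card (insert r (S - P)) = Suc (card (S - P))"
proof -
  have d: "set r \<inter> set q = {}" if "q \<in> S - P" for q
    using disj that unfolding system_verts_def by blast
  show "path_system (insert r (S - P))"
    using S r d unfolding path_system_def by blast
  have "r \<notin> S - P" using d[of r] r by (cases r) auto
  then show "card (insert r (S - P)) = Suc (card (S - P))"
    using path_systemD(1)[OF S] by simp
qed

lemma system_verts_Diff:
  assumes "path_system S" "P \<subseteq> S"
  shows "system_verts (S - P) = system_verts S - system_verts P"
  using assms path_systemD(5)[OF assms(1)] unfolding system_verts_def by blast

lemma path_system_extend: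
  assumes S: "path_system S" and a: "a \<in> system_ends S" and x: "x \<notin> system_verts S"
  obtains S' where "path_system S'" "card S' = card S"
    "system_verts S' = insert x (system_verts S)"
    "system_edges S' = insert {a, x} (system_edges S)"
proof -
  note pS = path_systemD[OF S]
  obtain p where p: "p \<in> S" "a \<in> {hd p, last p}" using a unfolding system_ends_def by blast
  obtain q where q: "last q = a" "set q = set p" "distinct q = distinct p"
    "length q = length p" "path_edges q = path_edges p"
    using path_reoriented[OF p(2) pS(4)[OF p(1)]] .
  let ?r = "q @ [x]"
  let ?S = "insert ?r (S - {p})"
  have xp: "x \<notin> set p" using x p(1) unfolding system_verts_def by blast
  have r: "2 \<le> length ?r" "distinct ?r" using q pS(2,3)[OF p(1)] xp by auto
  have disj: "set ?r \<inter> system_verts (S - {p}) = {}"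
    using system_verts_Diff[OF S, of "{p}"] p(1) x q(2) unfolding system_verts_def by auto
  note rep = path_system_replace[OF S r disj]
  have "q \<noteq> []" using q(4) pS(4)[OF p(1)] by auto
  then have "path_edges ?r = insert {a, x} (path_edges p)"
    using q by (simp add: path_edges_append)
  then have "system_edges ?S = insert {a, x} (system_edges S)"
    using p(1) unfolding system_edges_def by auto
  moreover have "system_verts ?S = insert x (system_verts S)"
    using p(1) q(2) unfolding system_verts_def by auto
  moreover have "card ?S = card S"
    using rep(2) card.remove[OF pS(1) p(1)] by simp
  ultimately show ?thesis using that rep(1) by blast
qed

text \<open>The list \<open>ms\<close> of inner vertices allows both a direct edge
  (\<open>[]\<close>) and a detour through a fresh vertex (\<open>[x]\<close>).\<close>

lemma path_system_join:
  assumes S: "path_system S" and p: "p \<in> S" "a \<in> {hd p, last p}"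
    and q: "q \<in> S" "b \<in> {hd q, last q}" "p \<noteq> q"
    and ms: "distinct ms" "set ms \<inter> system_verts S = {}"
  obtains S' where "path_system S'" "Suc (card S') = card S"
    "system_verts S' = set ms \<union> system_verts S"
    "system_edges S' = path_edges (a # ms @ [b]) \<union> system_edges S"
proof -
  note pS = path_systemD[OF S]
  obtain p' where p': "last p' = a" "set p' = set p" "distinct p' = distinct p"
    "length p' = length p" "path_edges p' = path_edges p"
    using path_reoriented[OF p(2) pS(4)[OF p(1)]] .
  obtain q' where q': "last q' = b" "set q' = set q" "distinct q' = distinct q"
    "length q' = length q" "path_edges q' = path_edges q"
    using path_reoriented[OF q(2) pS(4)[OF q(1)]] .
  let ?r = "p' @ ms @ rev q'"
  let ?S = "insert ?r (S - {p, q})"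
  have ne: "p' \<noteq> []" "q' \<noteq> []" using p'(4) q'(4) pS(4)[OF p(1)] pS(4)[OF q(1)] by auto
  have pq: "set p \<inter> set q = {}" using pS(5)[OF p(1) q(1)] q(3) by blast
  have sub: "set p \<subseteq> system_verts S" "set q \<subseteq> system_verts S"
    using p(1) q(1) unfolding system_verts_def by blast+
  have r: "2 \<le> length ?r" using p'(4) pS(2)[OF p(1)] by auto
  have "set p \<inter> set ms = {}" "set q \<inter> set ms = {}" using sub ms(2) by blast+
  then have r': "distinct ?r"
    using p' q' pS(3)[OF p(1)] pS(3)[OF q(1)] pq ms(1) by auto
  have disj: "set ?r \<inter> system_verts (S - {p, q}) = {}"
    using system_verts_Diff[OF S, of "{p, q}"] p(1) q(1) ms(2) p'(2) q'(2)
    unfolding system_verts_def by auto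
  note rep = path_system_replace[OF S r r' disj]
  have hdq: "hd (rev q') = b" using q'(1) ne(2) by (simp add: hd_rev)
  have "path_edges ?r = path_edges (a # ms @ [b]) \<union> path_edges p \<union> path_edges q"
  proof (cases "ms = []")
    case True
    then show ?thesis
      using ne hdq p'(1,5) q'(5) by (simp add: path_edges_append path_edges_rev)
  next
    case False
    then have "path_edges ((a # ms) @ [b]) = insert {last ms, b} (path_edges (a # ms))"
      by (subst path_edges_append) auto
    moreover have "path_edges ([a] @ ms) = insert {a, hd ms} (path_edges ms)"
      using False by (subst path_edges_append) auto
    ultimately show ?thesis
      using False ne hdq p'(1,5) q'(5) by (auto simp: path_edges_append path_edges_rev)
  qed
  then have "system_edges ?S = path_edges (a # ms @ [b]) \<union> system_edges S"
    using p(1) q(1) unfolding system_edges_def by blast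
  moreover have "system_verts ?S = set ms \<union> system_verts S"
    using p(1) q(1) p'(2) q'(2) unfolding system_verts_def by auto
  moreover have "Suc (card ?S) = card S"
  proof -
    have "card (S - {p, q}) = card S - card {p, q}"
      using p(1) q(1) by (intro card_Diff_subset) auto
    moreover have "card {p, q} \<le> card S" using p(1) q(1) pS(1) by (intro card_mono) auto
    ultimately show ?thesis using rep(2) q(3) by simp
  qed
  ultimately show ?thesis using that rep(1) by blast
qed

lemma path_system_map:
  assumes "path_system S" "inj f"
  shows "path_system (map f ` S)" "system_verts (map f ` S) = f ` system_verts S"
    "system_edges (map f ` S) = (`) f ` system_edges S"
proof -
  have inj: "inj_on f X" for X using assms(2) by (rule inj_on_subset) simp
  show "path_system (map f ` S)"
    unfolding path_system_def
  proof (intro conjI ballI impI)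
    fix p q assume pq: "p \<in> map f ` S" "q \<in> map f ` S" "p \<noteq> q"
    then obtain p' q' where "p' \<in> S" "q' \<in> S" "p = map f p'" "q = map f q'" "p' \<noteq> q'" by blast
    moreover from this have "set p' \<inter> set q' = {}"
      using assms(1) unfolding path_system_def by blast
    ultimately show "set p \<inter> set q = {}"
      using assms(2) by (simp add: image_Int[symmetric])
  qed (use assms(1) inj in \<open>auto simp: path_system_def distinct_map\<close>)
  show "system_verts (map f ` S) = f ` system_verts S"
    unfolding system_verts_def by auto
  show "system_edges (map f ` S) = (`) f ` system_edges S"
    unfolding system_edges_def by (auto simp: path_edges_map)
qed

section \<open>Path systems and linear forests\<close>

text \<open>Each component is represented by one vertex list. Components with a single vertex are
  dropped, as they carry no edges; hence only an inclusion for the vertices.\<close>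

lemma linear_forest_path_system:
  assumes F: "linear_forest F"
  obtains S where "path_system S" "system_edges S = edges F" "system_verts S \<subseteq> verts F"
proof -
  let ?R = "{(x, y). {x, y} \<in> edges F}\<^sup>*"
  have fin: "finite (verts F)" and simple: "\<And>e. e \<in> edges F \<Longrightarrow> e \<subseteq> verts F \<and> card e = 2"
    using F unfolding linear_forest_def finite_simple_graph_def by auto
  have "sym {(x, y). {x, y} \<in> edges F}" by (auto simp: sym_def insert_commute)
  then have R_sym: "(x, y) \<in> ?R \<Longrightarrow> (y, x) \<in> ?R" for x y
    by (meson sym_rtrancl symD)
  have R_trans: "(x, y) \<in> ?R \<Longrightarrow> (y, z) \<in> ?R \<Longrightarrow> (x, z) \<in> ?R" for x y z
    by (rule rtrancl_trans)
  have cv: "verts (component_of F v) = {w \<in> verts F. (v, w) \<in> ?R}" for v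
    by (simp add: component_of_def Let_def)
  have ce: "edges (component_of F v) = {e \<in> edges F. e \<subseteq> verts (component_of F v)}" for v
    by (simp add: component_of_def Let_def)
  \<comment> \<open>Reachability is an equivalence relation, so components sharing a vertex
    coincide.\<close>
  have same: "component_of F u = component_of F v"
    if "w \<in> verts (component_of F u)" "w \<in> verts (component_of F v)" for u v w
  proof -
    have "(u, v) \<in> ?R" "(v, u) \<in> ?R" using that R_sym R_trans unfolding cv by blast+
    then have "verts (component_of F u) = verts (component_of F v)"
      unfolding cv using R_trans by blast
    then show ?thesis using ce by (metis prod.expand)
  qed
  \<comment> \<open>The choice depends on the component and not on a vertex of it, so all vertices
    of a component receive the same list in the same orientation.\<close>
  define L where "L c = (SOME vs. vs \<noteq> [] \<and> distinct vs \<and> c = (set vs, path_edges vs))"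
    for c :: "'a graph"
  have L: "L c \<noteq> [] \<and> distinct (L c) \<and> c = (set (L c), path_edges (L c))"
    if "c \<in> component_of F ` verts F" for c
    using that F someI_ex[of "\<lambda>vs. vs \<noteq> [] \<and> distinct vs \<and> c = (set vs, path_edges vs)"]
    unfolding linear_forest_def path_graph_iff L_def by blast
  define S where "S = {p \<in> L ` component_of F ` verts F. 2 \<le> length p}"
  have L': "set (L (component_of F v)) = verts (component_of F v)"
      "path_edges (L (component_of F v)) = edges (component_of F v)" if "v \<in> verts F" for v
    using L[of "component_of F v"] that by (metis fst_conv imageI, metis snd_conv imageI)
  have disj: "p = q" if pq: "p \<in> S" "q \<in> S" and w: "w \<in> set p" "w \<in> set q" for p q w
  proof -
    obtain u v where "u \<in> verts F" "v \<in> verts F" "p = L (component_of F u)"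
      "q = L (component_of F v)" using pq unfolding S_def by blast
    then show ?thesis using same[of w u v] L'(1) w by auto
  qed
  have "finite S" unfolding S_def using fin by simp
  moreover have "\<forall>p\<in>S. 2 \<le> length p \<and> distinct p" unfolding S_def using L by blast
  ultimately have "path_system S"
    unfolding path_system_def using disj by blast
  moreover have "system_verts S \<subseteq> verts F"
    unfolding system_verts_def S_def using L'(1) cv by auto
  moreover have "system_edges S = edges F"
  proof
    show "system_edges S \<subseteq> edges F"
      unfolding system_edges_def S_def using L'(2) ce by auto
    show "edges F \<subseteq> system_edges S"
    proof
      fix e assume e: "e \<in> edges F"
      then obtain u w where uw: "e = {u, w}" "u \<noteq> w" using simple by (meson card_2_iff)
      then have uF: "u \<in> verts F" "w \<in> verts F" using simple e by blast+
      have "(u, w) \<in> ?R" using e uw by auto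
      then have "e \<subseteq> verts (component_of F u)" using uw uF cv by auto
      then have mem: "e \<in> path_edges (L (component_of F u))" using L'(2)[OF uF(1)] ce e by blast
      then have "2 \<le> length (L (component_of F u))"
        by (cases "L (component_of F u)" rule: path_edges.cases) auto
      then show "e \<in> system_edges S"
        using mem uF(1) unfolding system_edges_def S_def by blast
    qed
  qed
  ultimately show ?thesis using that by blast
qed

lemma path_connected:
  assumes "path_edges p \<subseteq> E" "w \<in> set p"
  shows "(hd p, w) \<in> {(x, y). {x, y} \<in> E}\<^sup>*"
  using assms
proof (induction p rule: path_edges.induct)
  case (1 x y zs)
  show ?case
  proof (cases "w = x")
    case False
    then have "(y, w) \<in> {(x, y). {x, y} \<in> E}\<^sup>*" using 1 by simp
    moreover have "(x, y) \<in> {(x, y). {x, y} \<in> E}" using 1 by simp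
    ultimately show ?thesis by (simp add: converse_rtrancl_into_rtrancl)
  qed simp
qed auto

text \<open>The component of \<open>v\<close> is the path through \<open>v\<close>: an edge of the
  system never leaves its path, and the path itself is connected.\<close>

lemma path_system_linear_forest:
  assumes S: "path_system S"
  shows "linear_forest (system_verts S, system_edges S)"
proof -
  let ?G = "(system_verts S, system_edges S)"
  let ?r = "{(x, y). {x, y} \<in> system_edges S}"
  note pS = path_systemD[OF S]
  have "finite_simple_graph ?G"
    unfolding finite_simple_graph_def
    using system_edges_subset system_edges_card[OF S] pS(1) by (auto simp: system_verts_def)
  moreover have "path_graph (component_of ?G v)" if v: "v \<in> system_verts S" for v
  proof -
    obtain p where p: "p \<in> S" "v \<in> set p" using v unfolding system_verts_def by blast
    have edge_in: "q = p" if "e \<in> path_edges q" "q \<in> S" "u \<in> e" "u \<in> set p" for e q u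
      using pS(5)[OF that(2) p(1)] path_edges_subset that by blast
    have stay: "w \<in> set p" if "(v, w) \<in> ?r\<^sup>*" for w
      using that
    proof (induction rule: rtrancl_induct)
      case (step y z)
      then obtain q where "q \<in> S" "{y, z} \<in> path_edges q" unfolding system_edges_def by blast
      then show ?case using edge_in[of "{y, z}" q y] step path_edges_subset by fastforce
    qed (use p in simp)
    have sub: "path_edges p \<subseteq> system_edges S" using p(1) unfolding system_edges_def by blast
    have "sym ?r" by (auto simp: sym_def insert_commute)
    then have "(v, hd p) \<in> ?r\<^sup>*" using path_connected[OF sub p(2)] by (meson sym_rtrancl symD)
    then have reach: "(v, w) \<in> ?r\<^sup>*" if "w \<in> set p" for w
      using path_connected[OF sub that] by (meson rtrancl_trans)
    have "{w \<in> system_verts S. (v, w) \<in> ?r\<^sup>*} = set p"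
      using stay reach p(1) unfolding system_verts_def by blast
    moreover have "{e \<in> system_edges S. e \<subseteq> set p} = path_edges p"
    proof
      show "{e \<in> system_edges S. e \<subseteq> set p} \<subseteq> path_edges p"
      proof
        fix e assume "e \<in> {e \<in> system_edges S. e \<subseteq> set p}"
        then obtain q where q: "q \<in> S" "e \<in> path_edges q" "e \<subseteq> set p"
          unfolding system_edges_def by blast
        \<comment> \<open>A common vertex of \<open>e\<close> and \<open>p\<close> is needed to
          identify \<open>q\<close> with \<open>p\<close>.\<close>
        moreover have "e \<noteq> {}" using path_edges_card[OF pS(3)[OF q(1)] q(2)] by auto
        ultimately show "e \<in> path_edges p" using edge_in by blast
      qed
    qed (use sub path_edges_subset in blast)
    ultimately have "component_of ?G v = (set p, path_edges p)"
      unfolding component_of_def by (simp add: Let_def)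
    then show ?thesis unfolding path_graph_iff using pS(3,4)[OF p(1)] by blast
  qed
  ultimately show ?thesis unfolding linear_forest_def by simp
qed

text \<open>The lists in \<open>pss\<close> cut \<open>vs\<close> at the edges outside \<open>F\<close>; keeping their order makes
  the induction on \<open>vs\<close> work.\<close>

lemma path_edges_preimage_lists:
  assumes "inj f" "(`) f ` F \<subseteq> path_edges vs"
  shows "\<exists>pss. [] \<notin> set pss \<and> map f (concat pss) = filter (\<lambda>x. x \<in> range f) vs \<and>
           (\<Union>p\<in>set pss. path_edges p) = F"
  using assms(2)
proof (induction vs arbitrary: F rule: path_edges.induct)
  case (1 x y zs)
  have inj: "f ` e = f ` e' \<longleftrightarrow> e = e'" for e e' using assms(1) by (rule inj_image_eq_iff)
  show ?case
  proof (cases "\<exists>u w. x = f u \<and> y = f w \<and> {u, w} \<in> F")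
    case True
    then obtain u w where uw: "x = f u" "y = f w" "{u, w} \<in> F" by blast
    have "(`) f ` (F - {{u, w}}) \<subseteq> path_edges (y # zs)"
    proof
      fix e assume "e \<in> (`) f ` (F - {{u, w}})"
      then obtain e' where e': "e' \<in> F" "e' \<noteq> {u, w}" "e = f ` e'" by blast
      then have "e \<noteq> {x, y}" using inj[of e' "{u, w}"] uw by auto
      then show "e \<in> path_edges (y # zs)" using 1(2) e' by auto
    qed
    from 1(1)[OF this] obtain pss where pss: "[] \<notin> set pss"
      "map f (concat pss) = filter (\<lambda>x. x \<in> range f) (y # zs)"
      "(\<Union>p\<in>set pss. path_edges p) = F - {{u, w}}" by blast
    \<comment> \<open>As \<open>y\<close> is in the range of \<open>f\<close>, the filtered list
      starts with \<open>y\<close>, so the first piece starts with \<open>w\<close>. Prepending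
      \<open>u\<close> to it adds exactly the edge \<open>{u, w}\<close>.\<close>
    then obtain p qss where pq: "pss = p # qss" "p \<noteq> []" using uw(2) by (cases pss) auto
    then obtain v ps where vp: "p = v # ps" by (cases p) auto
    have "f v = f w" using pss(2) pq vp uw(2) by simp
    then have "v = w" using assms(1) by (auto dest: injD)
    let ?pss = "(u # p) # qss"
    have "[] \<notin> set ?pss" using pss(1) pq by simp
    moreover have "map f (concat ?pss) = filter (\<lambda>x. x \<in> range f) (x # y # zs)"
      using pss(2) pq uw(1) by simp
    moreover have "(\<Union>p\<in>set ?pss. path_edges p) = F"
      using pss(3) pq vp \<open>v = w\<close> uw(3) by auto
    ultimately show ?thesis by blast
  next
    case False
    have "f ` e \<noteq> {x, y}" if e: "e \<in> F" for e
    proof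
      assume fe: "f ` e = {x, y}"
      then obtain u w where uw: "u \<in> e" "w \<in> e" "x = f u" "y = f w" by blast
      then have "f ` e = f ` {u, w}" using fe by simp
      then show False using inj False uw e by metis
    qed
    then have "(`) f ` F \<subseteq> path_edges (y # zs)" using 1(2) by (simp add: image_subset_iff)
    from 1(1)[OF this] obtain pss where pss: "[] \<notin> set pss"
      "map f (concat pss) = filter (\<lambda>x. x \<in> range f) (y # zs)"
      "(\<Union>p\<in>set pss. path_edges p) = F" by blast
    show ?thesis
    proof (cases "x \<in> range f")
      case True
      then obtain u where "x = f u" by blast
      then have "[] \<notin> set ([u] # pss) \<and>
          map f (concat ([u] # pss)) = filter (\<lambda>x. x \<in> range f) (x # y # zs) \<and>
          (\<Union>p\<in>set ([u] # pss). path_edges p) = F"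
        using pss by simp
      then show ?thesis by blast
    next
      case False
      then show ?thesis using pss by (intro exI[of _ pss]) simp
    qed
  qed
next
  case "2_1"
  then show ?case by (intro exI[of _ "[]"]) simp
next
  case ("2_2" v)
  show ?case
  proof (cases "v \<in> range f")
    case True
    then obtain u where "v = f u" by blast
    then show ?thesis using "2_2" by (intro exI[of _ "[[u]]"]) simp
  next
    case False
    then show ?thesis using "2_2" by (intro exI[of _ "[]"]) simp
  qed
qed

lemma path_edges_preimage_system:
  assumes f: "inj f" and vs: "distinct vs" and F: "(`) f ` F \<subseteq> path_edges vs"
  obtains S where "path_system S" "system_edges S = F" "f ` system_verts S \<subseteq> set vs"
proof -
  obtain pss where pss: "[] \<notin> set pss" "map f (concat pss) = filter (\<lambda>x. x \<in> range f) vs"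
    "(\<Union>p\<in>set pss. path_edges p) = F"
    using path_edges_preimage_lists[OF f F] by blast
  define S where "S = {p \<in> set pss. 2 \<le> length p}"
  have "distinct (map f (concat pss))" using pss(2) vs by simp
  then have d: "distinct (concat pss)" by (simp add: distinct_map)
  have "path_system S"
    unfolding path_system_def S_def using d by (auto simp: distinct_concat_iff)
  moreover have "system_edges S = F"
  proof -
    have "path_edges p = {}" if "\<not> 2 \<le> length p" for p :: "'a list"
      using that by (cases p rule: path_edges.cases) auto
    then show ?thesis using pss(3) unfolding system_edges_def S_def by blast
  qed
  moreover have "f ` system_verts S \<subseteq> set vs"
  proof -
    have "f ` system_verts S \<subseteq> set (map f (concat pss))"
      unfolding system_verts_def S_def by auto
    then show ?thesis unfolding pss(2) by auto
  qed
  ultimately show ?thesis using that by blast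
qed

section \<open>From path odd-covers to linear forests\<close>

text \<open>The injection \<open>f\<close> treats both inequalities at once: the identity for
  \<open>p2 G\<close>, and \<open>Inl\<close> when isolated vertices are added outside its
  range.\<close>

lemma linear_arboricity_le_path_odd_cover:
  fixes G :: "'a graph" and H :: "'b graph"
  assumes f: "inj f" and G: "finite_simple_graph G"
    and E: "edges H = (`) f ` edges G" and V: "verts H \<inter> range f \<subseteq> f ` verts G"
    and C: "path_odd_cover H C"
  shows "linear_arboricity G \<le> card C"
proof -
  have finC: "finite C" and paths: "\<And>P. P \<in> C \<Longrightarrow> path_graph P \<and> verts P \<subseteq> verts H"
    and cov: "{e. odd (card {P \<in> C. e \<in> edges P})} = edges H"
    using C unfolding path_odd_cover_def subgraph_def complete_graph_def by auto
  have "\<exists>P\<in>C. f ` e \<in> edges P" if "e \<in> edges G" for e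
  proof -
    have "odd (card {P \<in> C. f ` e \<in> edges P})" using that cov E by blast
    then have "{P \<in> C. f ` e \<in> edges P} \<noteq> {}" by (metis card.empty even_zero)
    then show ?thesis by blast
  qed
  \<comment> \<open>Assigning each edge to a single path makes the resulting forests edge-disjoint
    although the paths may overlap.\<close>
  then obtain pick where pick: "\<And>e. e \<in> edges G \<Longrightarrow> pick e \<in> C \<and> f ` e \<in> edges (pick e)"
    by metis
  have "\<forall>P\<in>C. \<exists>S. path_system S \<and> system_edges S = {e \<in> edges G. pick e = P} \<and>
      f ` system_verts S \<subseteq> verts P"
  proof
    fix P assume P: "P \<in> C"
    obtain vs where vs: "distinct vs" "P = (set vs, path_edges vs)"
      using paths[OF P] unfolding path_graph_iff by blast
    have "(`) f ` {e \<in> edges G. pick e = P} \<subseteq> path_edges vs" using pick vs(2) by fastforce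
    then obtain S where "path_system S" "system_edges S = {e \<in> edges G. pick e = P}"
      "f ` system_verts S \<subseteq> set vs"
      using path_edges_preimage_system[OF f vs(1)] by blast
    then show "\<exists>S. path_system S \<and> system_edges S = {e \<in> edges G. pick e = P} \<and>
        f ` system_verts S \<subseteq> verts P" using vs(2) by auto
  qed
  from bchoice[OF this] obtain S where S: "\<And>P. P \<in> C \<Longrightarrow> path_system (S P)"
    "\<And>P. P \<in> C \<Longrightarrow> system_edges (S P) = {e \<in> edges G. pick e = P}"
    "\<And>P. P \<in> C \<Longrightarrow> f ` system_verts (S P) \<subseteq> verts P"
    by blast
  define D where "D = (\<lambda>P. (system_verts (S P), system_edges (S P))) ` C"
  have "linear_forest_decomposition G D"
    unfolding linear_forest_decomposition_def
  proof (intro conjI ballI)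
    show "finite D" using finC unfolding D_def by simp
    fix F assume "F \<in> D"
    then obtain P where P: "P \<in> C" "F = (system_verts (S P), system_edges (S P))"
      unfolding D_def by blast
    show "linear_forest F" using path_system_linear_forest S(1) P by blast
    have "system_verts (S P) \<subseteq> verts G"
    proof
      fix v assume "v \<in> system_verts (S P)"
      then have "f v \<in> f ` verts G" using S(3)[OF P(1)] paths[OF P(1)] V by blast
      then show "v \<in> verts G" using f by (auto dest: injD)
    qed
    then show "subgraph F G" unfolding subgraph_def using P S(2)[OF P(1)] by auto
  next
    show "pairwise (\<lambda>F F'. edges F \<inter> edges F' = {}) D"
    proof (rule pairwiseI)
      fix F F' assume FF: "F \<in> D" "F' \<in> D" "F \<noteq> F'"
      then obtain P P' where "P \<in> C" "P' \<in> C" "F = (system_verts (S P), system_edges (S P))"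
        "F' = (system_verts (S P'), system_edges (S P'))" "P \<noteq> P'"
        unfolding D_def by blast
      then show "edges F \<inter> edges F' = {}" using S(2) by auto
    qed
    show "(\<Union>F\<in>D. edges F) = edges G" unfolding D_def using S(2) pick by auto
  qed
  then have "linear_arboricity G \<le> card D"
    unfolding linear_arboricity_def by (intro Least_le) blast
  \<comment> \<open>Paths that are assigned no edge may yield the same empty forest, so only an
    inequality holds.\<close>
  also have "card D \<le> card C" unfolding D_def by (rule card_image_le[OF finC])
  finally show ?thesis .
qed

section \<open>Attainment of the minima\<close>

lemma finite_edges: "finite_simple_graph G \<Longrightarrow> finite (edges G)"
  unfolding finite_simple_graph_def by (rule finite_subset[of _ "Pow (verts G)"]) auto

lemma path_odd_cover_exists:
  assumes G: "finite_simple_graph G"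
  shows "\<exists>C. path_odd_cover G C"
proof -
  define C where "C = (\<lambda>e. (e, {e})) ` edges G"
  have "path_graph (e, {e}) \<and> subgraph (e, {e}) (complete_graph (verts G))"
    if e: "e \<in> edges G" for e
  proof -
    have e2: "e \<subseteq> verts G" "card e = 2" using G e unfolding finite_simple_graph_def by auto
    then obtain u v where "e = {u, v}" "u \<noteq> v" by (meson card_2_iff)
    then have "path_graph (e, {e})"
      unfolding path_graph_iff by (intro exI[of _ "[u, v]"]) auto
    then show ?thesis using e2 unfolding subgraph_def complete_graph_def by auto
  qed
  moreover have "odd (card {P \<in> C. e \<in> edges P}) \<longleftrightarrow> e \<in> edges G" for e
  proof -
    have "{P \<in> C. e \<in> edges P} = (if e \<in> edges G then {(e, {e})} else {})"
      unfolding C_def by auto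
    then show ?thesis by simp
  qed
  ultimately have "path_odd_cover G C"
    unfolding path_odd_cover_def C_def using finite_edges[OF G] by auto
  then show ?thesis by blast
qed

lemma p2_attained:
  assumes "finite_simple_graph G"
  obtains C where "path_odd_cover G C" "card C = p2 G"
proof -
  obtain C where "path_odd_cover G C" using path_odd_cover_exists[OF assms] by blast
  then have "\<exists>C'. path_odd_cover G C' \<and> card C' = p2 G"
    unfolding p2_def using LeastI_ex[of "\<lambda>n. \<exists>C. path_odd_cover G C \<and> card C = n"] by blast
  then show ?thesis using that by blast
qed

lemma p2_le: "path_odd_cover G C \<Longrightarrow> p2 G \<le> card C"
  unfolding p2_def by (rule Least_le) blast

lemma linear_arboricity_attained:
  assumes G: "finite_simple_graph G"
  obtains D where "linear_forest_decomposition G D" "card D = linear_arboricity G"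
proof -
  define D where "D = (\<lambda>e. (e, {e})) ` edges G"
  have "linear_forest (e, {e}) \<and> subgraph (e, {e}) G" if e: "e \<in> edges G" for e
  proof -
    have e2: "e \<subseteq> verts G" "card e = 2" using G e unfolding finite_simple_graph_def by auto
    then obtain u v where uv: "e = {u, v}" "u \<noteq> v" by (meson card_2_iff)
    then have "linear_forest (system_verts {[u, v]}, system_edges {[u, v]})"
      by (intro path_system_linear_forest) (simp add: path_system_def)
    then show ?thesis
      using uv e e2 unfolding subgraph_def by (simp add: system_verts_def system_edges_def)
  qed
  then have "linear_forest_decomposition G D"
    unfolding linear_forest_decomposition_def D_def pairwise_def
    using finite_edges[OF G] by auto
  then have "\<exists>D'. linear_forest_decomposition G D' \<and> card D' = linear_arboricity G"
    unfolding linear_arboricity_def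
    using LeastI_ex[of "\<lambda>n. \<exists>D. linear_forest_decomposition G D \<and> card D = n"] by blast
  then show ?thesis using that by blast
qed

section \<open>From linear forests to path odd-covers\<close>

text \<open>Double counting of incidences.\<close>

lemma even_degree_sym_diff:
  assumes "finite I" "\<And>i. i \<in> I \<Longrightarrow> finite (E i)"
  shows "even (card {e. odd (card {i \<in> I. e \<in> E i}) \<and> v \<in> e}) \<longleftrightarrow>
         even (card {i \<in> I. odd (card {e \<in> E i. v \<in> e})})"
proof -
  define U where "U = {e \<in> (\<Union>i\<in>I. E i). v \<in> e}"
  have fU: "finite U" unfolding U_def using assms by simp
  have "(\<Sum>e\<in>U. card {i \<in> I. e \<in> E i}) = (\<Sum>i\<in>I. card {e \<in> U. e \<in> E i})"
    by (rule sum_multicount_gen[OF fU assms(1)]) auto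
  also have "\<dots> = (\<Sum>i\<in>I. card {e \<in> E i. v \<in> e})"
    by (intro sum.cong refl arg_cong[where f = card]) (auto simp: U_def)
  finally have "even (\<Sum>e\<in>U. card {i \<in> I. e \<in> E i}) = even (\<Sum>i\<in>I. card {e \<in> E i. v \<in> e})"
    by simp
  then have "even (card {e \<in> U. odd (card {i \<in> I. e \<in> E i})}) =
      even (card {i \<in> I. odd (card {e \<in> E i. v \<in> e})})"
    by (simp add: even_sum_iff fU assms(1))
  moreover have "{e \<in> U. odd (card {i \<in> I. e \<in> E i})} =
      {e. odd (card {i \<in> I. e \<in> E i}) \<and> v \<in> e}"
  proof -
    have "e \<in> (\<Union>i\<in>I. E i)" if "odd (card {i \<in> I. e \<in> E i})" for e
      using that by (metis (mono_tags, lifting) UN_I card.empty empty_Collect_eq even_zero)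
    then show ?thesis unfolding U_def by blast
  qed
  ultimately show ?thesis by simp
qed

text \<open>Invariance of the covered edge set: if \<open>N i\<close> are the edges newly added to
  member \<open>i\<close> and \<open>e\<close> is new in an even number of members, the parity at
  \<open>e\<close> is unchanged.\<close>

lemma odd_card_Un_even:
  assumes "finite I" "even (card {i \<in> I. e \<in> N i})" "\<And>i. i \<in> I \<Longrightarrow> E i \<inter> N i = {}"
    "\<And>i. i \<in> I \<Longrightarrow> E' i = N i \<union> E i"
  shows "odd (card {i \<in> I. e \<in> E' i}) \<longleftrightarrow> odd (card {i \<in> I. e \<in> E i})"
proof -
  have "{i \<in> I. e \<in> E' i} = {i \<in> I. e \<in> N i} \<union> {i \<in> I. e \<in> E i}" using assms(4) by blast
  moreover have "{i \<in> I. e \<in> N i} \<inter> {i \<in> I. e \<in> E i} = {}" using assms(3) by blast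
  ultimately show ?thesis using assms(1,2) by (simp add: card_Un_disjoint)
qed

text \<open>An indexed family, because distinct indices may come to carry equal systems and each has
  to be counted. The finite set \<open>A\<close> bounds the vertices in use, so anything outside it
  is fresh.\<close>

definition system_odd_cover ::
  "'i set \<Rightarrow> 'b set \<Rightarrow> 'b set set \<Rightarrow> ('i \<Rightarrow> 'b list set) \<Rightarrow> bool" where
  "system_odd_cover I A E f \<longleftrightarrow> finite I \<and> finite A \<and>
     (\<forall>i\<in>I. path_system (f i) \<and> system_verts (f i) \<subseteq> A) \<and>
     (\<forall>e. odd (card {i \<in> I. e \<in> system_edges (f i)}) \<longleftrightarrow> e \<in> E)"

lemma even_card_other:
  assumes "even (card X)" "finite X" "m \<in> X"
  obtains j where "j \<in> X" "j \<noteq> m"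
proof -
  have "X \<noteq> {m}" using assms(1) by auto
  then show ?thesis using that assms(3) by blast
qed

text \<open>An end \<open>a\<close> of a path in \<open>f m\<close> is also an end in some other \<open>f j\<close>, since degrees are
  even, and so is an end \<open>b\<close> of another path in \<open>f m\<close> in some \<open>f l\<close>. We may choose \<open>b\<close> so
  that it is not the opposite end of \<open>a\<close> in \<open>f j\<close>. If \<open>j = l\<close>, the edge \<open>ab\<close> is added to both
  \<open>f m\<close> and \<open>f j\<close>; otherwise a fresh vertex \<open>x\<close> is used, \<open>f m\<close> receives \<open>ax\<close> and \<open>xb\<close>,
  \<open>f j\<close> receives \<open>ax\<close> and \<open>f l\<close> receives \<open>xb\<close>.\<close>

lemma system_odd_cover_step:
  assumes f: "system_odd_cover I A E f" and ev: "\<And>v. even (card {e \<in> E. v \<in> e})"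
    and C: "card I \<le> 2 \<or> infinite C" and m: "m \<in> I" "2 \<le> card (f m)"
  obtains B f' where "finite B" "B \<subseteq> C" "system_odd_cover I (A \<union> B) E f'"
    "(\<Sum>i\<in>I. card (f' i)) < (\<Sum>i\<in>I. card (f i))"
proof -
  have fI: "finite I" and fA: "finite A" and sys: "\<And>i. i \<in> I \<Longrightarrow> path_system (f i)"
    and ver: "\<And>i. i \<in> I \<Longrightarrow> system_verts (f i) \<subseteq> A"
    and par: "\<And>e. odd (card {i \<in> I. e \<in> system_edges (f i)}) \<longleftrightarrow> e \<in> E"
    using f unfolding system_odd_cover_def by auto
  \<comment> \<open>Being an end of \<open>f i\<close> means having odd degree in it, and these
    parities add up to the even degree of \<open>v\<close> in \<open>E\<close>.\<close>
  have even_ends: "even (card {i \<in> I. v \<in> system_ends (f i)})" for v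
  proof -
    have "{i \<in> I. odd (card {e \<in> system_edges (f i). v \<in> e})} = {i \<in> I. v \<in> system_ends (f i)}"
      using odd_degree_system_edges[OF sys] by (intro Collect_cong conj_cong refl)
    then show ?thesis
      using even_degree_sym_diff[OF fI, of "\<lambda>i. system_edges (f i)" v]
        finite_system_edges[OF sys] ev[of v] unfolding par by simp
  qed
  have other: "\<exists>j\<in>I. j \<noteq> m \<and> v \<in> system_ends (f j)" if "v \<in> system_ends (f m)" for v
    using even_card_other[OF even_ends[of v], of m] fI m(1) that by auto
  note mS = path_systemD[OF sys[OF m(1)]]
  obtain p q where pq: "p \<in> f m" "q \<in> f m" "p \<noteq> q"
    using m(2) mS(1) by (metis card_le_Suc0_iff_eq not_less_eq_eq numeral_2_eq_2)
  define a where "a = hd p"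
  have ends_in: "hd r \<in> set r" "last r \<in> set r" if "r \<in> f m" for r
    using mS(4)[OF that] by auto
  have ap: "a \<in> {hd p, last p}" unfolding a_def by simp
  then have "a \<in> system_ends (f m)" using pq unfolding system_ends_def by blast
  then obtain j where j: "j \<in> I" "j \<noteq> m" "a \<in> system_ends (f j)" using other by blast
  note jS = path_systemD[OF sys[OF j(1)]]
  obtain r where r: "r \<in> f j" "a \<in> {hd r, last r}" using j(3) unfolding system_ends_def by blast
  have ab_ne: "v \<noteq> a" if "v \<in> set q" for v
    using mS(5)[OF pq(1,2), of v] pq that ends_in[OF pq(1)] a_def by blast
  \<comment> \<open>The ends of \<open>q\<close> are distinct and both differ from \<open>a\<close>,
    while \<open>r\<close> has at most one end other than \<open>a\<close>. So one end of
    \<open>q\<close> is not an end of \<open>r\<close>.\<close>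
  have "hd q \<noteq> last q" using hd_neq_last mS(2,3) pq(2) by blast
  then have "hd q \<notin> {hd r, last r} \<or> last q \<notin> {hd r, last r}"
    using r(2) ab_ne[OF ends_in(1)[OF pq(2)]] ab_ne[OF ends_in(2)[OF pq(2)]] by auto
  then obtain b where b: "b \<in> {hd q, last q}" "b \<notin> {hd r, last r}" by blast
  have bq: "b \<in> set q" using b(1) ends_in[OF pq(2)] by auto
  have ab: "a \<noteq> b" using ab_ne[OF bq] by simp
  have aA: "a \<in> A" "b \<in> A"
    using ver[OF m(1)] pq ends_in bq unfolding a_def system_verts_def by blast+
  show ?thesis
  proof (cases "b \<in> system_ends (f j)")
    case True
    then obtain t where t: "t \<in> f j" "b \<in> {hd t, last t}" unfolding system_ends_def by blast
    have rt: "r \<noteq> t" using b t by blast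
    obtain Sm where Sm: "path_system Sm" "Suc (card Sm) = card (f m)"
      "system_verts Sm = system_verts (f m)" "system_edges Sm = {{a, b}} \<union> system_edges (f m)"
      using path_system_join[OF sys[OF m(1)] pq(1) ap pq(2) b(1) pq(3), of "[]"] by auto
    obtain Sj where Sj: "path_system Sj" "Suc (card Sj) = card (f j)"
      "system_verts Sj = system_verts (f j)" "system_edges Sj = {{a, b}} \<union> system_edges (f j)"
      using path_system_join[OF sys[OF j(1)] r(1) r(2) t(1) t(2) rt, of "[]"] by auto
    define f' where "f' = f(m := Sm, j := Sj)"
    define N where "N i = (if i \<in> {m, j} then {{a, b}} else {})" for i
    have nm: "{a, b} \<notin> system_edges (f m)"
      using system_edges_same_path[OF sys[OF m(1)] pq(1) _ pq(2) bq] ends_in(1)[OF pq(1)] pq(3)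
      unfolding a_def by blast
    have nj: "{a, b} \<notin> system_edges (f j)"
    proof -
      have "a \<in> set r" "b \<in> set t" using r t jS(4) by auto
      then show ?thesis using system_edges_same_path[OF sys[OF j(1)] r(1) _ t(1)] rt by blast
    qed
    have "odd (card {i \<in> I. e \<in> system_edges (f' i)}) \<longleftrightarrow> e \<in> E" for e
    proof -
      have "{i \<in> I. e \<in> N i} = (if e = {a, b} then {m, j} else {})"
        using m(1) j(1) unfolding N_def by auto
      then have "even (card {i \<in> I. e \<in> N i})" using j(2) by auto
      from odd_card_Un_even[where E = "\<lambda>i. system_edges (f i)" and E' = "\<lambda>i. system_edges (f' i)",
          OF fI this] show ?thesis
        unfolding par using nm nj Sm(4) Sj(4) by (auto simp: N_def f'_def)
    qed
    then have "system_odd_cover I (A \<union> {}) E f'"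
      unfolding system_odd_cover_def using fI fA sys ver Sm(1,3) Sj(1,3) m(1) j(1)
      by (auto simp: f'_def)
    moreover have "(\<Sum>i\<in>I. card (f' i)) < (\<Sum>i\<in>I. card (f i))"
      using Sm(2) Sj(2) m(1) j(2) by (intro sum_strict_mono_ex1[OF fI]) (auto simp: f'_def)
    ultimately show ?thesis using that[of "{}" f'] by blast
  next
    case False
    have "b \<in> system_ends (f m)" using b(1) pq(2) unfolding system_ends_def by blast
    then obtain l where l: "l \<in> I" "l \<noteq> m" "b \<in> system_ends (f l)" using other by blast
    have lj: "l \<noteq> j" using False l by blast
    \<comment> \<open>Three distinct indices rule out \<open>card I \<le> 2\<close>, so the
      reservoir \<open>C\<close> is infinite and contains a vertex outside the finite set
      \<open>A\<close>.\<close>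
    have "card {m, j, l} \<le> card I" using fI m(1) j(1) l(1) by (intro card_mono) auto
    then have "infinite C" using C lj l(2) j(2) by simp
    then obtain x where x: "x \<in> C" "x \<notin> A" using fA by (meson finite_subset subsetI)
    have xv: "x \<notin> system_verts (f i)" if "i \<in> I" for i using ver[OF that] x(2) by blast
    have xe: "e \<notin> system_edges (f i)" if "i \<in> I" "x \<in> e" for i e
      using system_edges_subset[of e "f i"] xv that by blast
    obtain Sm where Sm: "path_system Sm" "Suc (card Sm) = card (f m)"
      "system_verts Sm = {x} \<union> system_verts (f m)"
      "system_edges Sm = {{a, x}, {x, b}} \<union> system_edges (f m)"
      using path_system_join[OF sys[OF m(1)] pq(1) ap pq(2) b(1) pq(3), of "[x]"] xv[OF m(1)]
      by auto
    obtain Sj where Sj: "path_system Sj" "card Sj = card (f j)"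
      "system_verts Sj = insert x (system_verts (f j))"
      "system_edges Sj = insert {a, x} (system_edges (f j))"
      using path_system_extend[OF sys[OF j(1)] j(3) xv[OF j(1)]] .
    obtain Sl where Sl: "path_system Sl" "card Sl = card (f l)"
      "system_verts Sl = insert x (system_verts (f l))"
      "system_edges Sl = insert {b, x} (system_edges (f l))"
      using path_system_extend[OF sys[OF l(1)] l(3) xv[OF l(1)]] .
    define f' where "f' = f(m := Sm, j := Sj, l := Sl)"
    define N where "N i = (if i = m then {{a, x}, {x, b}} else if i = j then {{a, x}}
      else if i = l then {{x, b}} else {})" for i
    have axb: "{a, x} \<noteq> {x, b}" using ab aA x(2) by (auto simp: doubleton_eq_iff)
    have "odd (card {i \<in> I. e \<in> system_edges (f' i)}) \<longleftrightarrow> e \<in> E" for e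
    proof -
      have "{i \<in> I. e \<in> N i} =
          (if e = {a, x} then {m, j} else if e = {x, b} then {m, l} else {})"
        using m(1) j(1,2) l(1,2) lj axb unfolding N_def by auto
      then have "even (card {i \<in> I. e \<in> N i})" using j(2) l(2) by auto
      moreover have "system_edges (f i) \<inter> N i = {}" if "i \<in> I" for i
        using xe[OF that] unfolding N_def by auto
      moreover have "system_edges (f' i) = N i \<union> system_edges (f i)" for i
        using Sm(4) Sj(4) Sl(4) j(2) l(2) lj by (auto simp: N_def f'_def insert_commute)
      ultimately show ?thesis
        using odd_card_Un_even[where E = "\<lambda>i. system_edges (f i)" and
            E' = "\<lambda>i. system_edges (f' i)", OF fI] par by simp
    qed
    then have "system_odd_cover I (A \<union> {x}) E f'"
      unfolding system_odd_cover_def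
      using fI fA sys ver Sm(1,3) Sj(1,3) Sl(1,3) m(1) j(1) l(1) by (auto simp: f'_def)
    \<comment> \<open>Only \<open>f m\<close> loses a path here; the paths in \<open>f j\<close> and
      \<open>f l\<close> are merely prolonged.\<close>
    moreover have "(\<Sum>i\<in>I. card (f' i)) < (\<Sum>i\<in>I. card (f i))"
      using Sm(2) Sj(2) Sl(2) m(1) j(2) l(2) lj
      by (intro sum_strict_mono_ex1[OF fI]) (auto simp: f'_def)
    ultimately show ?thesis using that[of "{x}" f'] x(1) by blast
  qed
qed

text \<open>Strong induction on the total number of paths, with \<open>A\<close> generalized because
  every step may add a fresh vertex to it.\<close>

lemma system_odd_cover_paths:
  assumes "system_odd_cover I A E f" "\<And>v. even (card {e \<in> E. v \<in> e})"
    "card I \<le> 2 \<or> infinite C"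
  shows "\<exists>f' B. finite B \<and> B \<subseteq> C \<and> system_odd_cover I (A \<union> B) E f' \<and> (\<forall>i\<in>I. card (f' i) \<le> 1)"
  using assms(1)
proof (induction "\<Sum>i\<in>I. card (f i)" arbitrary: f A rule: less_induct)
  case less
  show ?case
  proof (cases "\<forall>i\<in>I. card (f i) \<le> 1")
    case True
    then show ?thesis using less(2) by (intro exI[of _ f] exI[of _ "{}"]) simp
  next
    case False
    then obtain m where m: "m \<in> I" "2 \<le> card (f m)" by fastforce
    obtain B f' where B: "finite B" "B \<subseteq> C" "system_odd_cover I (A \<union> B) E f'"
      "(\<Sum>i\<in>I. card (f' i)) < (\<Sum>i\<in>I. card (f i))"
      using system_odd_cover_step[OF less(2) assms(2,3) m] .
    obtain f'' B' where "finite B'" "B' \<subseteq> C" "system_odd_cover I ((A \<union> B) \<union> B') E f''"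
      "\<forall>i\<in>I. card (f'' i) \<le> 1"
      using less(1)[OF B(4,3)] by (elim exE conjE)
    then show ?thesis using B(1,2)
      by (intro exI[of _ f''] exI[of _ "B \<union> B'"]) (auto simp: Un_assoc)
  qed
qed

text \<open>Equal members of the family cancel in pairs.\<close>

lemma family_to_set_mod_2:
  assumes "finite I"
  shows "\<exists>C \<subseteq> P ` I. card C \<le> card I \<and>
    (\<forall>e. odd (card {X \<in> C. e \<in> h X}) \<longleftrightarrow> odd (card {i \<in> I. e \<in> h (P i)}))"
  using assms
proof (induction I rule: finite_induct)
  case (insert i I)
  then obtain C where C: "C \<subseteq> P ` I" "card C \<le> card I"
    "\<And>e. odd (card {X \<in> C. e \<in> h X}) \<longleftrightarrow> odd (card {i \<in> I. e \<in> h (P i)})" by blast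
  have fC: "finite C" using C(1) insert(1) by (rule finite_subset[OF _ finite_imageI])
  have I': "{k \<in> insert i I. e \<in> h (P k)} =
      (if e \<in> h (P i) then insert i {k \<in> I. e \<in> h (P k)} else {k \<in> I. e \<in> h (P k)})" for e by auto
  have oddI: "odd (card {k \<in> insert i I. e \<in> h (P k)}) \<longleftrightarrow> (odd (card {X \<in> C. e \<in> h X}) \<noteq> (e \<in> h (P i)))" for e
    unfolding I' C(3) using insert(1,2) by auto
  show ?case
  \<comment> \<open>Adding the index \<open>i\<close> flips the parity at exactly the elements of
    \<open>h (P i)\<close>; so does removing \<open>P i\<close> from \<open>C\<close> if present and
    inserting it otherwise.\<close>
  proof (cases "P i \<in> C")
    case True
    have "odd (card {X \<in> C - {P i}. e \<in> h X}) \<longleftrightarrow> (odd (card {X \<in> C. e \<in> h X}) \<noteq> (e \<in> h (P i)))" for e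
    proof (cases "e \<in> h (P i)")
      case ei: True
      have "{X \<in> C. e \<in> h X} = insert (P i) {X \<in> C - {P i}. e \<in> h X}" using True ei by auto
      then have "card {X \<in> C. e \<in> h X} = Suc (card {X \<in> C - {P i}. e \<in> h X})" using fC by simp
      then show ?thesis using ei by simp
    next
      case False
      then have "{X \<in> C. e \<in> h X} = {X \<in> C - {P i}. e \<in> h X}" by auto
      then show ?thesis using False by simp
    qed
    moreover have "card (C - {P i}) \<le> card (insert i I)"
      using C(2) insert(1,2) card_Diff1_le[of C "P i"] by simp
    ultimately show ?thesis using C(1) oddI by (intro exI[of _ "C - {P i}"]) auto
  next
    case False
    have "{X \<in> insert (P i) C. e \<in> h X} =
        (if e \<in> h (P i) then insert (P i) {X \<in> C. e \<in> h X} else {X \<in> C. e \<in> h X})" for e by auto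
    then have "odd (card {X \<in> insert (P i) C. e \<in> h X}) \<longleftrightarrow> (odd (card {X \<in> C. e \<in> h X}) \<noteq> (e \<in> h (P i)))" for e
      using False fC by auto
    moreover have "card (insert (P i) C) \<le> card (insert i I)"
      using C(2) insert(1,2) fC False by simp
    ultimately show ?thesis using C(1) oddI by (intro exI[of _ "insert (P i) C"]) auto
  qed
qed auto

lemma system_odd_cover_path_odd_cover:
  assumes f: "system_odd_cover I A E f" and one: "\<And>i. i \<in> I \<Longrightarrow> card (f i) \<le> 1"
  obtains C where "path_odd_cover (A, E) C" "card C \<le> card I"
proof -
  have fI: "finite I" and sys: "\<And>i. i \<in> I \<Longrightarrow> path_system (f i)"
    and ver: "\<And>i. i \<in> I \<Longrightarrow> system_verts (f i) \<subseteq> A"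
    and par: "\<And>e. odd (card {i \<in> I. e \<in> system_edges (f i)}) \<longleftrightarrow> e \<in> E"
    using f unfolding system_odd_cover_def by auto
  \<comment> \<open>An empty system provides no path and contributes no edge; its index is
    discarded.\<close>
  define J where "J = {i \<in> I. f i \<noteq> {}}"
  have "\<exists>p. f i = {p}" if "i \<in> J" for i
  proof -
    have "card (f i) = 1"
      using one[of i] path_systemD(1)[OF sys, of i] that unfolding J_def
      by (simp add: le_Suc_eq)
    then show ?thesis by (simp add: card_1_singleton_iff)
  qed
  then obtain g where g: "\<And>i. i \<in> J \<Longrightarrow> f i = {g i}" by metis
  define P where "P i = (set (g i), path_edges (g i))" for i
  have fJ: "finite J" unfolding J_def using fI by simp
  obtain C where C: "C \<subseteq> P ` J" "card C \<le> card J"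
    "\<And>e. odd (card {X \<in> C. e \<in> edges X}) \<longleftrightarrow> odd (card {i \<in> J. e \<in> edges (P i)})"
    using family_to_set_mod_2[OF fJ, of P edges] by blast
  have path: "path_graph (P i) \<and> subgraph (P i) (complete_graph A)" if i: "i \<in> J" for i
  proof -
    have "i \<in> I" using i unfolding J_def by simp
    then have gi: "distinct (g i)" "g i \<noteq> []" "set (g i) \<subseteq> A"
      using path_systemD(3,4)[OF sys, of i "g i"] ver[of i] g[OF i]
      by (auto simp: system_verts_def)
    then show ?thesis
      unfolding P_def path_graph_iff subgraph_def complete_graph_def
      using path_edges_subset path_edges_card[OF gi(1)] by auto
  qed
  have "odd (card {X \<in> C. e \<in> edges X}) \<longleftrightarrow> e \<in> E" for e
  proof -
    have "edges (P i) = system_edges (f i)" if "i \<in> J" for i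
      by (simp add: g[OF that] P_def system_edges_def)
    moreover have "system_edges (f i) = {}" if "i \<in> I" "i \<notin> J" for i
      using that by (simp add: J_def system_edges_def)
    ultimately have "{i \<in> J. e \<in> edges (P i)} = {i \<in> I. e \<in> system_edges (f i)}"
      unfolding J_def by blast
    then show ?thesis unfolding C(3) using par by simp
  qed
  then have "path_odd_cover (A, E) C"
    unfolding path_odd_cover_def using C(1) path finite_subset[OF C(1) finite_imageI[OF fJ]] by auto
  moreover have "card J \<le> card I" unfolding J_def using fI by (intro card_mono) auto
  ultimately show ?thesis using that C(2) by force
qed

text \<open>The joining step asks for even degree at every element of the target type; elements
  outside the image of the vertex set lie on no edge.\<close>

lemma even_degree_image:
  assumes G: "finite_simple_graph G" "eulerian G" and f: "inj f"
  shows "even (card {e \<in> (`) f ` edges G. v \<in> e})"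
proof (cases "v \<in> f ` verts G")
  case True
  then obtain u where u: "u \<in> verts G" "v = f u" by blast
  have "{e \<in> (`) f ` edges G. v \<in> e} = (`) f ` {e \<in> edges G. u \<in> e}"
    using u f by (auto dest: injD)
  then have "card {e \<in> (`) f ` edges G. v \<in> e} = degree G u"
    unfolding degree_def by (simp add: card_image inj_on_def inj_image_eq_iff[OF f])
  then show ?thesis using G(2) u(1) unfolding eulerian_def by simp
next
  case False
  then have empty: "{e \<in> (`) f ` edges G. v \<in> e} = {}"
    using G(1) unfolding finite_simple_graph_def by blast
  show ?thesis unfolding empty by simp
qed

text \<open>Both upper bounds are instances: \<open>Inl\<close> with the infinite reservoir of
  \<open>Inr\<close> vertices, and the identity with an empty reservoir when there are at most two
  forests.\<close>

lemma path_odd_cover_of_linear_forests: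
  fixes G :: "'a graph" and f :: "'a \<Rightarrow> 'b"
  assumes G: "finite_simple_graph G" "eulerian G" and f: "inj f"
    and D: "linear_forest_decomposition G D" and C: "card D \<le> 2 \<or> infinite C"
  obtains B Q where "finite B" "B \<subseteq> C" "path_odd_cover (f ` verts G \<union> B, (`) f ` edges G) Q"
    "card Q \<le> card D"
proof -
  have finD: "finite D" and lf: "\<And>F. F \<in> D \<Longrightarrow> linear_forest F \<and> subgraph F G"
    and disj: "pairwise (\<lambda>F F'. edges F \<inter> edges F' = {}) D"
    and un: "(\<Union>F\<in>D. edges F) = edges G"
    using D unfolding linear_forest_decomposition_def by auto
  have "\<forall>F\<in>D. \<exists>S. path_system S \<and> system_edges S = edges F \<and> system_verts S \<subseteq> verts G"
  proof
    fix F assume F: "F \<in> D"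
    obtain S where "path_system S" "system_edges S = edges F" "system_verts S \<subseteq> verts F"
      using linear_forest_path_system[of F] lf[OF F] by blast
    then show "\<exists>S. path_system S \<and> system_edges S = edges F \<and> system_verts S \<subseteq> verts G"
      using lf[OF F] unfolding subgraph_def by blast
  qed
  from bchoice[OF this] obtain S where S: "\<And>F. F \<in> D \<Longrightarrow> path_system (S F)"
    "\<And>F. F \<in> D \<Longrightarrow> system_edges (S F) = edges F"
    "\<And>F. F \<in> D \<Longrightarrow> system_verts (S F) \<subseteq> verts G"
    by blast
  define g where "g F = map f ` S F" for F
  have "odd (card {F \<in> D. e \<in> system_edges (g F)}) \<longleftrightarrow> e \<in> (`) f ` edges G" for e
  proof (cases "e \<in> (`) f ` edges G")
    case True
    then obtain e' where e': "e = f ` e'" "e' \<in> edges G" by blast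
    \<comment> \<open>Edge-disjointness makes \<open>F\<close> the only forest containing the edge,
      so the initial count is 1 and hence odd.\<close>
    then obtain F where F: "F \<in> D" "e' \<in> edges F" using un by blast
    have "F' = F" if "F' \<in> D" "e' \<in> edges F'" for F'
      using disj that F unfolding pairwise_def by blast
    moreover have "e \<in> system_edges (g F') \<longleftrightarrow> e' \<in> edges F'" if "F' \<in> D" for F'
      unfolding g_def path_system_map(3)[OF S(1)[OF that] f] S(2)[OF that] e'(1)
      by (auto simp: inj_image_eq_iff[OF f])
    ultimately have "{F \<in> D. e \<in> system_edges (g F)} = {F}" using F by blast
    then show ?thesis using True by simp
  next
    case False
    moreover have "system_edges (g F) = (`) f ` edges F" if "F \<in> D" for F
      unfolding g_def path_system_map(3)[OF S(1)[OF that] f] S(2)[OF that] ..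
    ultimately have empty: "{F \<in> D. e \<in> system_edges (g F)} = {}" using un by blast
    show ?thesis unfolding empty using False by simp
  qed
  then have cover: "system_odd_cover D (f ` verts G) ((`) f ` edges G) g"
    unfolding system_odd_cover_def g_def
    using finD G(1) path_system_map(1,2)[OF S(1) f] image_mono[OF S(3), of _ f]
    by (simp add: finite_simple_graph_def)
  obtain g' B where B: "finite B" "B \<subseteq> C"
    "system_odd_cover D (f ` verts G \<union> B) ((`) f ` edges G) g'" "\<forall>F\<in>D. card (g' F) \<le> 1"
    using system_odd_cover_paths[OF cover even_degree_image[OF G f] C] by (elim exE conjE)
  obtain Q where "path_odd_cover (f ` verts G \<union> B, (`) f ` edges G) Q" "card Q \<le> card D"
    using system_odd_cover_path_odd_cover[OF B(3)] bspec[OF B(4)] by blast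
  then show ?thesis using that B(1,2) by blast
qed

lemma path_odd_cover_mono:
  assumes C: "path_odd_cover (V, E) C" and V: "V \<subseteq> V'"
  shows "path_odd_cover (V', E) C"
proof -
  have "subgraph P (complete_graph V')" if "subgraph P (complete_graph V)" for P
    using that V unfolding subgraph_def complete_graph_def by auto
  then show ?thesis using C unfolding path_odd_cover_def by simp
qed

section \<open>Comparison of the three parameters\<close>

lemma finite_simple_graph_add_isolated:
  "finite_simple_graph G \<Longrightarrow> finite_simple_graph (add_isolated k G)"
  unfolding finite_simple_graph_def add_isolated_def by (auto simp: card_image)

lemma linear_arboricity_le_p2_add_isolated:
  assumes "finite_simple_graph G"
  shows "linear_arboricity G \<le> p2 (add_isolated k G)"
proof -
  obtain C where C: "path_odd_cover (add_isolated k G) C" "card C = p2 (add_isolated k G)"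
    using p2_attained[OF finite_simple_graph_add_isolated[OF assms]] .
  have "linear_arboricity G \<le> card C"
    by (rule linear_arboricity_le_path_odd_cover[OF _ assms _ _ C(1), of Inl])
      (auto simp: add_isolated_def)
  then show ?thesis using C(2) by simp
qed

lemma linear_arboricity_le_p2:
  assumes "finite_simple_graph G"
  shows "linear_arboricity G \<le> p2 G"
proof -
  obtain C where C: "path_odd_cover G C" "card C = p2 G" using p2_attained[OF assms] .
  have "linear_arboricity G \<le> card C"
    by (rule linear_arboricity_le_path_odd_cover[OF inj_on_id assms _ _ C(1)]) auto
  then show ?thesis using C(2) by simp
qed

theorem theorem1p2:
  fixes G :: "'a graph"
  assumes "finite_simple_graph G" and "eulerian G"
  shows "p2_iso G = linear_arboricity G \<and>
         (linear_arboricity G \<le> 2 \<longrightarrow> p2 G = linear_arboricity G)"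
proof (intro conjI impI)
  obtain D where D: "linear_forest_decomposition G D" "card D = linear_arboricity G"
    using linear_arboricity_attained[OF assms(1)] .
  have "infinite (range (Inr :: nat \<Rightarrow> 'a + nat))" by (simp add: finite_image_iff)
  then obtain B Q where B: "finite B" "B \<subseteq> range (Inr :: nat \<Rightarrow> 'a + nat)"
    and Q: "path_odd_cover (Inl ` verts G \<union> B, (`) Inl ` edges G) Q" "card Q \<le> card D"
    using path_odd_cover_of_linear_forests[OF assms inj_Inl D(1)] by metis
  obtain N where N: "finite N" "B = Inr ` N" using B by (meson finite_subset_image)
  \<comment> \<open>The fresh vertices need not form an initial segment; enlarging them to one only
    adds further isolated vertices.\<close>
  obtain k where "N \<subseteq> {..<k}" using N(1) by (auto simp: finite_nat_set_iff_bounded)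
  then have "path_odd_cover (add_isolated k G) Q"
    using path_odd_cover_mono[OF Q(1), of "Inl ` verts G \<union> Inr ` {..<k}"] N(2)
    unfolding add_isolated_def by blast
  then have "p2 (add_isolated k G) \<le> card Q" by (rule p2_le)
  moreover have "p2_iso G \<le> p2 (add_isolated k G)"
    unfolding p2_iso_def by (rule Least_le) blast
  \<comment> \<open>The lower bound holds for every \<open>k\<close>, in particular for one
    attaining the minimum.\<close>
  moreover have "\<exists>k. p2 (add_isolated k G) = p2_iso G"
    unfolding p2_iso_def by (rule LeastI_ex) blast
  ultimately show "p2_iso G = linear_arboricity G"
    using Q(2) D(2) linear_arboricity_le_p2_add_isolated[OF assms(1)] by (metis le_antisym order_trans)
  assume "linear_arboricity G \<le> 2"
  then obtain B Q where "B \<subseteq> {}" "path_odd_cover (id ` verts G \<union> B, (`) id ` edges G) Q"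
      "card Q \<le> card D"
    using path_odd_cover_of_linear_forests[OF assms inj_on_id D(1), of "{}"] D(2) by metis
  then have "p2 G \<le> card D" using p2_le[of G Q] by simp
  then show "p2 G = linear_arboricity G"
    using D(2) linear_arboricity_le_p2[OF assms(1)] by simp
qed

end
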